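(* Let $G$ be a finite Frobenius group with abelian complement, and let $G'=[G,G]$ (so that $G'$ is the Frobenius kernel of $G$ and $(G,G')$ is a strong Gelfand pair). Then $$\mathcal{S}(G,G')=\mathcal{G}(G')\wr\mathcal{G}(G/G').$$
   Context: For $H\le G$ and $g\in G$ put $g^H=\{h^{-1}gh : h\in H\}$. These $H$-classes partition $G$, and their sums span a Schur ring $\mathbb{C}[G]^H\subseteq\mathbb{C}[G]$. The pair $(G,H)$ is a strong Gelfand pair if $\mathbb{C}[G]^H$ is commutative. In that case, $\mathcal{S}(G,H)$ denotes the corresponding association scheme on the set $G$: for the $H$-classes $P_0=\{e\},P_1,\dots,P_d$ the relations are $R_i=\{(x,y)\in G\times G: yx^{-1}\in P_i\}$, with adjacency matrices $(A_i)_{xy}=1$ if $yx^{-1}\in P_i$ and $0$ otherwise. For a finite group $K$, $\mathcal{G}(K)=\mathcal{S}(K,K)$ is the group association scheme (relations given by conjugacy classes of $K$). Wreath product: if $\mathcal{A}$ has adjacency matrices $A_0=I_u,A_1,\dots,A_r$ (of size $u$) and $\mathcal{B}$ has adjacency matrices $B_0=I_v,B_1,\dots,B_s$ (of size $v$), then $\mathcal{A}\wr\mathcal{B}$ is the scheme on $uv$ points with adjacency matrices $I_v\otimes A_i$ $(0\le i\le r)$ and $B_j\otimes J_u$ $(1\le j\le s)$, where $J_u$ is the all-ones $u\times u$ matrix. Equality of schemes on different underlying sets is understood up to a bijection of the underlying sets (isomorphism): for suitable orderings of the points the two schemes have the same set of adjacency matrices. A group $G$ is a Frobenius group with Frobenius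 kernel $N$ if $N$ is a nontrivial proper normal subgroup with $C_G(x)\le N$ for all $e\ne x\in N$; a complement is a subgroup $K$ with $NK=G$, $N\cap K=\{e\}$. *)

theory Defs
  imports Complex_Main "HOL-Algebra.Generated_Groups"
begin

section \<open>Frobenius groups\<close>

definition centralizer :: "('a, 'm) monoid_scheme \<Rightarrow> 'a \<Rightarrow> 'a set" where
  "centralizer G x = {g \<in> carrier G. g \<otimes>\<^bsub>G\<^esub> x = x \<otimes>\<^bsub>G\<^esub> g}"

definition frobenius_kernel :: "'a set \<Rightarrow> ('a, 'm) monoid_scheme \<Rightarrow> bool" where
  "frobenius_kernel N G \<longleftrightarrow>
     N \<lhd> G \<and> N \<noteq> {\<one>\<^bsub>G\<^esub>} \<and> N \<noteq> carrier G \<and>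
     (\<forall>x \<in> N - {\<one>\<^bsub>G\<^esub>}. centralizer G x \<subseteq> N)"

definition group_complement :: "'a set \<Rightarrow> 'a set \<Rightarrow> ('a, 'm) monoid_scheme \<Rightarrow> bool" where
  "group_complement K N G \<longleftrightarrow>
     subgroup K G \<and> N <#>\<^bsub>G\<^esub> K = carrier G \<and> N \<inter> K = {\<one>\<^bsub>G\<^esub>}"


section \<open>Strong Gelfand pairs\<close>

definition conj_class :: "('a, 'm) monoid_scheme \<Rightarrow> 'a set \<Rightarrow> 'a \<Rightarrow> 'a set" where
  "conj_class G H g = {inv\<^bsub>G\<^esub> h \<otimes>\<^bsub>G\<^esub> g \<otimes>\<^bsub>G\<^esub> h | h. h \<in> H}"

definition conj_classes :: "('a, 'm) monoid_scheme \<Rightarrow> 'a set \<Rightarrow> 'a set set" where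
  "conj_classes G H = conj_class G H ` carrier G"

text \<open>
  For a finite group, the elements of the complex group algebra are represented by their
  coefficient functions, which vanish outside the carrier.
\<close>

definition group_alg_mult ::
    "('a, 'm) monoid_scheme \<Rightarrow> ('a \<Rightarrow> complex) \<Rightarrow> ('a \<Rightarrow> complex) \<Rightarrow> 'a \<Rightarrow> complex" where
  "group_alg_mult G a b =
     (\<lambda>x. if x \<in> carrier G
          then \<Sum>y\<in>carrier G. a y * b (inv\<^bsub>G\<^esub> y \<otimes>\<^bsub>G\<^esub> x) else 0)"

definition class_sum :: "'a set \<Rightarrow> 'a \<Rightarrow> complex" where
  "class_sum P = (\<lambda>x. of_bool (x \<in> P))"

definition schur_ring :: "('a, 'm) monoid_scheme \<Rightarrow> 'a set \<Rightarrow> ('a \<Rightarrow> complex) set" where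
  "schur_ring G H =
     {(\<lambda>x. \<Sum>P\<in>conj_classes G H. c P * class_sum P x) | c :: 'a set \<Rightarrow> complex. True}"

definition strong_gelfand_pair :: "('a, 'm) monoid_scheme \<Rightarrow> 'a set \<Rightarrow> bool" where
  "strong_gelfand_pair G H \<longleftrightarrow>
     group G \<and> finite (carrier G) \<and> subgroup H G \<and>
     (\<forall>a \<in> schur_ring G H. \<forall>b \<in> schur_ring G H.
        group_alg_mult G a b = group_alg_mult G b a)"


section \<open>Schemes and their wreath product\<close>

text \<open>
  A scheme is given by its set of points together with its set of adjacency matrices.  A
  matrix with rows and columns indexed by a set \<open>X\<close> is a two-argument function that vanishes
  outside \<open>X \<times> X\<close>.  The record carries only this data and does not impose the axioms of an
  association scheme.
\<close>

type_synonym 'a sq_matrix = "'a \<Rightarrow> 'a \<Rightarrow> complex"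

record 'a scheme =
  points :: "'a set"
  adj_matrices :: "'a sq_matrix set"

definition adj_matrix :: "('a \<times> 'a) set \<Rightarrow> 'a sq_matrix" where
  "adj_matrix R = (\<lambda>x y. of_bool ((x, y) \<in> R))"

definition ident_matrix :: "'a set \<Rightarrow> 'a sq_matrix" where
  "ident_matrix X = (\<lambda>x y. of_bool (x \<in> X \<and> x = y))"

definition ones_matrix :: "'a set \<Rightarrow> 'a sq_matrix" where
  "ones_matrix X = (\<lambda>x y. of_bool (x \<in> X \<and> y \<in> X))"

definition kronecker :: "'a sq_matrix \<Rightarrow> 'b sq_matrix \<Rightarrow> ('a \<times> 'b) sq_matrix" where
  "kronecker M N = (\<lambda>x y. M (fst x) (fst y) * N (snd x) (snd y))"

definition cayley_relation :: "('a, 'm) monoid_scheme \<Rightarrow> 'a set \<Rightarrow> ('a \<times> 'a) set" where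
  "cayley_relation G P =
     {(x, y) \<in> carrier G \<times> carrier G. y \<otimes>\<^bsub>G\<^esub> inv\<^bsub>G\<^esub> x \<in> P}"

definition pair_scheme :: "('a, 'm) monoid_scheme \<Rightarrow> 'a set \<Rightarrow> 'a scheme" where
  "pair_scheme G H =
     \<lparr>points = carrier G,
      adj_matrices = (\<lambda>P. adj_matrix (cayley_relation G P)) ` conj_classes G H\<rparr>"

definition group_scheme :: "('a, 'm) monoid_scheme \<Rightarrow> 'a scheme" where
  "group_scheme K = pair_scheme K (carrier K)"

text \<open>
  In \<open>wreath_scheme \<A> \<B>\<close> the Kronecker factor coming from \<open>\<B>\<close> stands on the left, so points
  are pairs of a point of \<open>\<B>\<close> and a point of \<open>\<A>\<close>.  The adjacency matrix \<open>B\<^sub>0\<close> that is left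
  out of the second family is the identity matrix.
\<close>

definition wreath_scheme :: "'a scheme \<Rightarrow> 'b scheme \<Rightarrow> ('b \<times> 'a) scheme" where
  "wreath_scheme \<A> \<B> =
     \<lparr>points = points \<B> \<times> points \<A>,
      adj_matrices =
        (\<lambda>A. kronecker (ident_matrix (points \<B>)) A) ` adj_matrices \<A> \<union>
        (\<lambda>B. kronecker B (ones_matrix (points \<A>))) `
          (adj_matrices \<B> - {ident_matrix (points \<B>)})\<rparr>"

definition reindex_matrix :: "'a set \<Rightarrow> ('a \<Rightarrow> 'b) \<Rightarrow> 'b sq_matrix \<Rightarrow> 'a sq_matrix" where
  "reindex_matrix X f M = (\<lambda>x y. if x \<in> X \<and> y \<in> X then M (f x) (f y) else 0)"

definition scheme_iso :: "'a scheme \<Rightarrow> 'b scheme \<Rightarrow> bool" where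
  "scheme_iso \<A> \<B> \<longleftrightarrow>
     (\<exists>f. bij_betw f (points \<A>) (points \<B>) \<and>
          reindex_matrix (points \<A>) f ` adj_matrices \<B> = adj_matrices \<A>)"

end

theory Submission
  imports Defs
begin

text \<open>
  If \<open>g\<close> lies outside the kernel \<open>N\<close>, no nontrivial element of \<open>N\<close> commutes with \<open>g\<close>, so the
  \<open>N\<close>-class of \<open>g\<close> has \<open>card N\<close> elements and fills the coset \<open>N g\<close>.  Hence every element of
  \<open>N\<close> is a commutator, and \<open>G' = N\<close> because \<open>G/N\<close> is abelian.  The relations of the pair
  \<open>(G, N)\<close> are thus the classes of \<open>N\<close> inside each coset and the nontrivial elements of \<open>G/N\<close>
  between cosets, which is the wreath product.
\<close>

section \<open>Conjugacy classes of a subgroup\<close>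

lemma (in group) conj_class_self:
  assumes "subgroup H G" "g \<in> carrier G"
  shows "g \<in> conj_class G H g"
  unfolding conj_class_def using assms subgroup.one_closed[OF assms(1)] by force

lemma (in group) conj_class_trans:
  assumes "subgroup H G" "g \<in> carrier G" "x \<in> conj_class G H g" "y \<in> conj_class G H x"
  shows "y \<in> conj_class G H g"
proof -
  obtain h k where hk: "h \<in> H" "k \<in> H" "x = inv h \<otimes> g \<otimes> h" "y = inv k \<otimes> x \<otimes> k"
    using assms(3,4) unfolding conj_class_def by auto
  have hk': "h \<in> carrier G" "k \<in> carrier G"
    using hk assms(1) by (auto dest: subgroup.mem_carrier)
  have "y = inv (h \<otimes> k) \<otimes> g \<otimes> (h \<otimes> k)"
    using hk hk' assms(2) by (simp add: m_assoc inv_mult_group)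
  moreover have "h \<otimes> k \<in> H"
    using hk assms(1) by (simp add: subgroup.m_closed)
  ultimately show ?thesis
    unfolding conj_class_def by blast
qed

lemma (in group) conj_class_sym:
  assumes "subgroup H G" "g \<in> carrier G" "x \<in> conj_class G H g"
  shows "g \<in> conj_class G H x"
proof -
  obtain h where h: "h \<in> H" "x = inv h \<otimes> g \<otimes> h"
    using assms(3) unfolding conj_class_def by auto
  have h': "h \<in> carrier G"
    using h assms(1) by (auto dest: subgroup.mem_carrier)
  have "inv (inv h) \<otimes> x \<otimes> inv h = h \<otimes> inv h \<otimes> g \<otimes> (h \<otimes> inv h)"
    using h(2) h' assms(2) by (simp only: m_assoc inv_inv inv_closed m_closed)
  then have "g = inv (inv h) \<otimes> x \<otimes> inv h"
    using h' assms(2) by simp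
  moreover have "inv h \<in> H"
    using h assms(1) by (simp add: subgroup.m_inv_closed)
  ultimately show ?thesis
    unfolding conj_class_def by blast
qed

lemma (in group) conj_class_in_carrier:
  assumes "subgroup H G" "g \<in> carrier G"
  shows "conj_class G H g \<subseteq> carrier G"
  unfolding conj_class_def using assms by (auto dest: subgroup.mem_carrier)

lemma (in comm_group) conj_class_comm:
  assumes "subgroup H G" "g \<in> carrier G"
  shows "conj_class G H g = {g}"
proof
  show "conj_class G H g \<subseteq> {g}"
  proof
    fix x assume "x \<in> conj_class G H g"
    then obtain h where "h \<in> H" "x = inv h \<otimes> g \<otimes> h"
      unfolding conj_class_def by auto
    moreover from this have "h \<in> carrier G"
      using assms(1) by (auto dest: subgroup.mem_carrier)
    ultimately have "x = g \<otimes> (inv h \<otimes> h)"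
      using assms(2) by (simp only: m_comm[of "inv h" g] m_assoc inv_closed)
    then show "x \<in> {g}"
      using \<open>h \<in> carrier G\<close> assms(2) by simp
  qed
qed (use conj_class_self[OF assms] in simp)

text \<open>Inverses in the subgroup agree with those of \<open>G\<close>, so the classes of
  \<open>H\<close> as a group in its own right can be treated as classes of the pair.\<close>

lemma (in group) conj_class_consistent:
  assumes "subgroup H G"
  shows "conj_class (G\<lparr>carrier := H\<rparr>) H g = conj_class G H g"
  unfolding conj_class_def using m_inv_consistent[OF assms] by force

text \<open>Being in one \<open>H\<close>-class is an equivalence relation, so \<open>x\<close> and
  \<open>y\<close> lie in the same members of \<open>conj_classes G H\<close> and every class sum
  agrees on them.\<close>

lemma (in group) schur_ring_class_function:
  assumes "a \<in> schur_ring G H" "subgroup H G" "x \<in> carrier G" "y \<in> conj_class G H x"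
  shows "a y = a x"
proof -
  obtain c where a: "a = (\<lambda>x. \<Sum>P\<in>conj_classes G H. c P * class_sum P x)"
    using assms(1) unfolding schur_ring_def by auto
  have y: "y \<in> carrier G"
    using conj_class_in_carrier[OF assms(2,3)] assms(4) by auto
  have "class_sum P y = class_sum P x" if P: "P \<in> conj_classes G H" for P
  proof -
    obtain g where g: "g \<in> carrier G" "P = conj_class G H g"
      using P unfolding conj_classes_def by auto
    have "y \<in> P \<longleftrightarrow> x \<in> P"
      using conj_class_trans[OF assms(2) g(1)] conj_class_sym[OF assms(2,3,4)] assms(4)
      unfolding g(2) by blast
    then show ?thesis
      unfolding class_sum_def by simp
  qed
  then show ?thesis
    unfolding a by (intro sum.cong) auto
qed

text \<open>The substitution of \<open>inv y \<otimes> x\<close> for \<open>y\<close> moves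
  \<open>a\<close> to the front. Comparing \<open>a * b\<close> with \<open>b * a\<close> then only
  means comparing \<open>b\<close> at \<open>inv y \<otimes> x\<close> and at
  \<open>x \<otimes> inv y\<close>.\<close>

lemma (in group) group_alg_mult_commuted:
  assumes "x \<in> carrier G"
  shows "group_alg_mult G b a x = (\<Sum>y\<in>carrier G. a y * b (x \<otimes> inv y))"
proof -
  have "(\<Sum>y\<in>carrier G. b y * a (inv y \<otimes> x)) = (\<Sum>y\<in>carrier G. a y * b (x \<otimes> inv y))"
    by (rule sum.reindex_bij_witness[where j = "\<lambda>y. inv y \<otimes> x" and i = "\<lambda>y. x \<otimes> inv y"])
      (use assms in \<open>auto simp: inv_mult_group m_assoc[symmetric] mult.commute\<close>,
        auto simp: m_assoc)
  then show ?thesis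
    using assms unfolding group_alg_mult_def by simp
qed

section \<open>Pairs whose outer classes are cosets\<close>

text \<open>These two properties of a Frobenius kernel with abelian complement carry both the
  commutativity of the Schur ring and the wreath decomposition.\<close>

locale coset_class_pair = normal N G for N and G (structure) +
  assumes quotient_comm: "comm_group (G Mod N)"
    and conj_class_outside: "g \<in> carrier G \<Longrightarrow> g \<notin> N \<Longrightarrow> conj_class G N g = N #> g"
begin

section \<open>Cosets modulo \<open>N\<close>\<close>

lemma rcos_mult_comm:
  assumes "x \<in> carrier G" "y \<in> carrier G"
  shows "N #> (x \<otimes> y) = N #> (y \<otimes> x)"
proof -
  have "N #> x \<in> carrier (G Mod N)" "N #> y \<in> carrier (G Mod N)"
    using assms by (auto simp: FactGroup_def RCOSETS_def)
  then have "(N #> x) <#> (N #> y) = (N #> y) <#> (N #> x)"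
    using comm_monoid.m_comm[OF comm_group.axioms(1)[OF quotient_comm]] by simp
  then show ?thesis
    using assms by (simp add: rcos_sum)
qed

lemma rcos_eq_iff:
  assumes "x \<in> carrier G" "y \<in> carrier G"
  shows "N #> y = N #> x \<longleftrightarrow> y \<otimes> inv x \<in> N"
  using assms repr_independence repr_independenceD rcos_module is_group subgroup_axioms
  by metis

lemma rcos_eq_self_iff:
  assumes "x \<in> carrier G"
  shows "N #> x = N \<longleftrightarrow> x \<in> N"
  using assms coset_join1 coset_join2 subgroup_axioms by blast

lemma conj_class_inside:
  assumes "g \<in> N"
  shows "conj_class G N g \<subseteq> N"
  unfolding conj_class_def using assms by auto

section \<open>Commutativity of the Schur ring\<close>

text \<open>If \<open>y \<in> N\<close>, the conjugate is in the \<open>N\<close>-class of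
  \<open>u\<close> by definition. If \<open>u \<notin> N\<close>, conjugation by any
  \<open>y\<close> keeps \<open>u\<close> in its coset, because the quotient is abelian, and that
  coset is a single class.\<close>

lemma schur_ring_conj:
  assumes b: "b \<in> schur_ring G N" and u: "u \<in> carrier G" and y: "y \<in> carrier G"
    and "y \<in> N \<or> u \<notin> N"
  shows "b (inv y \<otimes> u \<otimes> y) = b u"
proof (rule schur_ring_class_function[OF b subgroup_axioms u])
  show "inv y \<otimes> u \<otimes> y \<in> conj_class G N u"
  proof (cases "y \<in> N")
    case True
    then show ?thesis unfolding conj_class_def by blast
  next
    case False
    have "N #> (inv y \<otimes> (u \<otimes> y)) = N #> (u \<otimes> y \<otimes> inv y)"
      using u y by (intro rcos_mult_comm) auto
    also have "u \<otimes> y \<otimes> inv y = u"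
      using u y by (simp add: m_assoc)
    finally have "inv y \<otimes> u \<otimes> y \<in> N #> u"
      using u y repr_independenceD[OF subgroup_axioms, of "inv y \<otimes> u \<otimes> y" u]
      by (simp add: m_assoc)
    then show ?thesis
      using False assms(4) conj_class_outside[OF u] by simp
  qed
qed

text \<open>The two convolution sums agree term by term except possibly for \<open>y\<close> in the
  coset of an \<open>x\<close> outside \<open>N\<close>. On that coset \<open>a\<close> is constant,
  and both sums of \<open>b\<close> run once over \<open>N\<close>.\<close>

lemma schur_ring_comm:
  assumes fin: "finite (carrier G)" and a: "a \<in> schur_ring G N" and b: "b \<in> schur_ring G N"
  shows "group_alg_mult G a b = group_alg_mult G b a"
proof
  fix x
  show "group_alg_mult G a b x = group_alg_mult G b a x"
  proof (cases "x \<in> carrier G")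
    case False
    then show ?thesis unfolding group_alg_mult_def by simp
  next
    case x: True
    \<comment> \<open>The two arguments are conjugate by \<open>y\<close>; the side condition is the
      one of \<open>schur_ring_conj\<close> for \<open>u = x \<otimes> inv y\<close>.\<close>
    have generic: "b (inv y \<otimes> x) = b (x \<otimes> inv y)"
      if "y \<in> carrier G" "y \<in> N \<or> x \<otimes> inv y \<notin> N" for y
    proof -
      have "inv y \<otimes> x = inv y \<otimes> (x \<otimes> inv y) \<otimes> y"
        using x that(1) by (simp add: m_assoc)
      then show ?thesis
        using schur_ring_conj[OF b _ that(1), of "x \<otimes> inv y"] x that by simp
    qed
    have "(\<Sum>y\<in>carrier G. a y * b (inv y \<otimes> x)) = (\<Sum>y\<in>carrier G. a y * b (x \<otimes> inv y))"
    proof (cases "x \<in> N")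
      case True
      \<comment> \<open>With \<open>x \<in> N\<close>, the element \<open>x \<otimes> inv y\<close>
        can lie in \<open>N\<close> only if \<open>y\<close> does.\<close>
      have "y \<in> N \<or> x \<otimes> inv y \<notin> N" if "y \<in> carrier G" for y
        using that x True rcos_eq_iff[of y x] rcos_eq_self_iff[of x] rcos_eq_self_iff[of y]
        by auto
      then show ?thesis
        using generic by (intro sum.cong) auto
    next
      case False
      let ?C = "N #> x"
      have C: "?C \<subseteq> carrier G"
        using x by (simp add: r_coset_subset_G subset)
      have memC: "y \<in> ?C \<longleftrightarrow> x \<otimes> inv y \<in> N" if "y \<in> carrier G" for y
        using that x rcos_eq_iff[of y x] repr_independence repr_independenceD subgroup_axioms
        by metis
      have const: "a y = a x" if "y \<in> ?C" for y
        using that schur_ring_class_function[OF a subgroup_axioms x] conj_class_outside x False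
        by simp
      \<comment> \<open>Modulo \<open>N\<close>, \<open>y\<close> and \<open>x\<close> coincide, so
        \<open>y \<mapsto> inv y \<otimes> x\<close> maps the coset bijectively onto
        \<open>N\<close>; \<open>right\<close> does the same with the factors in the other
        order.\<close>
      have left: "(\<Sum>y\<in>?C. b (inv y \<otimes> x)) = (\<Sum>n\<in>N. b n)"
      proof (rule sum.reindex_bij_witness[where j = "\<lambda>y. inv y \<otimes> x" and i = "\<lambda>n. x \<otimes> inv n"])
        fix y assume y: "y \<in> ?C"
        then have yG: "y \<in> carrier G" using C by auto
        show "x \<otimes> inv (inv y \<otimes> x) = y"
          using x yG by (simp add: inv_mult_group m_assoc[symmetric])
        have "N #> (inv y \<otimes> x) = N #> (x \<otimes> inv y)"
          using x yG by (intro rcos_mult_comm) auto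
        then show "inv y \<otimes> x \<in> N"
          using y memC[OF yG] x yG rcos_eq_self_iff[of "inv y \<otimes> x"]
            rcos_eq_self_iff[of "x \<otimes> inv y"] by simp
      next
        fix n assume n: "n \<in> N"
        then have nG: "n \<in> carrier G" by auto
        show "inv (x \<otimes> inv n) \<otimes> x = n"
          using x nG by (simp add: inv_mult_group m_assoc)
        show "x \<otimes> inv n \<in> ?C"
          using x n nG memC inv_op_closed2[of x n] by (simp add: inv_mult_group m_assoc)
      qed simp
      have right: "(\<Sum>y\<in>?C. b (x \<otimes> inv y)) = (\<Sum>n\<in>N. b n)"
      proof (rule sum.reindex_bij_witness[where j = "\<lambda>y. x \<otimes> inv y" and i = "\<lambda>n. inv n \<otimes> x"])
        fix y assume y: "y \<in> ?C"
        then have yG: "y \<in> carrier G" using C by auto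
        show "inv (x \<otimes> inv y) \<otimes> x = y"
          using x yG by (simp add: inv_mult_group m_assoc)
        show "x \<otimes> inv y \<in> N"
          using y memC[OF yG] by simp
      next
        fix n assume n: "n \<in> N"
        then have nG: "n \<in> carrier G" by auto
        show "x \<otimes> inv (inv n \<otimes> x) = n"
          using x nG by (simp add: inv_mult_group m_assoc[symmetric])
        show "inv n \<otimes> x \<in> ?C"
          using n x subset by (intro rcosI) auto
      qed simp
      have "(\<Sum>y\<in>?C. a y * b (inv y \<otimes> x)) = (\<Sum>y\<in>?C. a y * b (x \<otimes> inv y))"
        using left right const by (simp add: sum_distrib_left[symmetric])
      moreover have "(\<Sum>y\<in>carrier G - ?C. a y * b (inv y \<otimes> x)) =
          (\<Sum>y\<in>carrier G - ?C. a y * b (x \<otimes> inv y))"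
        using generic memC by (intro sum.cong) auto
      ultimately show ?thesis
        by (simp only: sum.subset_diff[OF C fin])
    qed
    then show ?thesis
      using group_alg_mult_commuted[OF x] x unfolding group_alg_mult_def by simp
  qed
qed

section \<open>Relations of the pair and of the quotient\<close>

lemma conj_classes_eq:
  "conj_classes G N = conj_class G N ` N \<union> (\<lambda>g. N #> g) ` (carrier G - N)"
proof -
  have "carrier G = N \<union> (carrier G - N)"
    using subset by auto
  then have "conj_classes G N = conj_class G N ` N \<union> conj_class G N ` (carrier G - N)"
    unfolding conj_classes_def by (metis image_Un)
  also have "conj_class G N ` (carrier G - N) = (\<lambda>g. N #> g) ` (carrier G - N)"
    using conj_class_outside by (intro image_cong) auto
  finally show ?thesis .
qed

lemma carrier_quotient: "carrier (G Mod N) = (\<lambda>g. N #> g) ` carrier G"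
  by (auto simp: FactGroup_def RCOSETS_def)

lemma cayley_relation_quotient:
  assumes "x \<in> carrier G" "y \<in> carrier G" "g \<in> carrier G"
  shows "(N #> x, N #> y) \<in> cayley_relation (G Mod N) {N #> g} \<longleftrightarrow>
    (x, y) \<in> cayley_relation G (N #> g)"
proof -
  have "N #> x \<in> carrier (G Mod N)"
    using assms carrier_quotient by auto
  then have "(N #> y) <#> inv\<^bsub>G Mod N\<^esub> (N #> x) = N #> (y \<otimes> inv x)"
    using assms by (simp add: inv_FactGroup rcos_inv rcos_sum)
  moreover have "N #> (y \<otimes> inv x) = N #> g \<longleftrightarrow> y \<otimes> inv x \<in> N #> g"
    using assms repr_independence repr_independenceD subgroup_axioms inv_closed m_closed by metis
  ultimately show ?thesis
    using assms carrier_quotient unfolding cayley_relation_def by auto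
qed

text \<open>Classes of the abelian quotient are singletons \<open>{N #> g}\<close>, and such a class
  gives the identity matrix exactly when \<open>g \<in> N\<close>. Removing that matrix therefore
  leaves the cosets other than \<open>N\<close>.\<close>

lemma adj_quotient_nonidentity:
  "adj_matrices (group_scheme (G Mod N)) - {ident_matrix (carrier (G Mod N))} =
    (\<lambda>g. adj_matrix (cayley_relation (G Mod N) {N #> g})) ` (carrier G - N)"
proof -
  interpret Q: comm_group "G Mod N" by (rule quotient_comm)
  have classes: "conj_classes (G Mod N) (carrier (G Mod N)) = (\<lambda>g. {N #> g}) ` carrier G"
    unfolding conj_classes_def carrier_quotient image_image
    using Q.conj_class_comm[OF Q.subgroup_self] by (intro image_cong) (auto simp: carrier_quotient)
  have "adj_matrix (cayley_relation (G Mod N) {N #> g}) = ident_matrix (carrier (G Mod N))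
      \<longleftrightarrow> g \<in> N" (is "?A = ?I \<longleftrightarrow> _") if g: "g \<in> carrier G" for g
  proof
    have gQ: "N #> g \<in> carrier (G Mod N)"
      using g carrier_quotient by auto
    \<comment> \<open>One entry suffices: the matrix has a 1 in the row of the identity and the
      column of \<open>N #> g\<close>, which in the identity matrix forces
      \<open>N #> g = N\<close>.\<close>
    then have "(\<one>\<^bsub>G Mod N\<^esub>, N #> g) \<in> cayley_relation (G Mod N) {N #> g}"
      unfolding cayley_relation_def using Q.inv_one Q.r_one[OF gQ] Q.one_closed by simp
    then have "?A \<one>\<^bsub>G Mod N\<^esub> (N #> g) = 1"
      unfolding adj_matrix_def by simp
    moreover assume "?A = ?I"
    ultimately have "?I \<one>\<^bsub>G Mod N\<^esub> (N #> g) = 1"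
      by (simp only:)
    then have "N #> g = N"
      unfolding ident_matrix_def by (simp split: if_splits)
    then show "g \<in> N"
      using rcos_eq_self_iff[OF g] by simp
  next
    assume "g \<in> N"
    then have "N #> g = \<one>\<^bsub>G Mod N\<^esub>"
      using rcos_eq_self_iff[OF g] by simp
    moreover have "y \<otimes>\<^bsub>G Mod N\<^esub> inv\<^bsub>G Mod N\<^esub> x = \<one>\<^bsub>G Mod N\<^esub> \<longleftrightarrow> x = y"
      if "x \<in> carrier (G Mod N)" "y \<in> carrier (G Mod N)" for x y
      using that Q.inv_equality Q.inv_inv Q.r_inv Q.inv_closed by metis
    ultimately show "?A = ?I"
      unfolding adj_matrix_def ident_matrix_def cayley_relation_def
      by (intro ext) auto
  qed
  then show ?thesis
    unfolding group_scheme_def pair_scheme_def by (auto simp: classes)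
qed

section \<open>The isomorphism with the wreath product\<close>

text \<open>A choice of coset representatives identifies \<open>G\<close> with pairs of a coset and
  an element of \<open>N\<close>. Inside one coset the representative cancels from
  \<open>y \<otimes> inv x\<close>, leaving the relations of \<open>N\<close>; between distinct
  cosets only the coset of \<open>y \<otimes> inv x\<close> matters.\<close>

theorem pair_scheme_iso_wreath:
  "scheme_iso (pair_scheme G N)
    (wreath_scheme (group_scheme (G\<lparr>carrier := N\<rparr>)) (group_scheme (G Mod N)))"
proof -
  define t where "t C = (SOME g. g \<in> C)" for C :: "'a set"
  \<comment> \<open>The representative is divided off on the right so that it cancels in quotients
    \<open>y \<otimes> inv x\<close>. The inverse map multiplies it back.\<close>
  define f where "f x = (N #> x, x \<otimes> inv (t (N #> x)))" for x
  have t: "t (N #> x) \<in> carrier G" "N #> t (N #> x) = N #> x" if "x \<in> carrier G" for x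
  proof -
    have "t (N #> x) \<in> N #> x"
      unfolding t_def using rcos_self[OF that subgroup_axioms] by (rule someI)
    then show "t (N #> x) \<in> carrier G" "N #> t (N #> x) = N #> x"
      using that elemrcos_carrier[OF is_group] repr_independence[OF _ that subgroup_axioms]
      by auto
  qed
  have f_snd: "x \<otimes> inv (t (N #> x)) \<in> N" if "x \<in> carrier G" for x
    using that t rcos_eq_iff by metis
  have bij: "bij_betw f (carrier G) (carrier (G Mod N) \<times> N)"
  proof (rule bij_betw_byWitness[where f' = "\<lambda>(C, n). n \<otimes> t C"])
    show "\<forall>x\<in>carrier G. (case f x of (C, n) \<Rightarrow> n \<otimes> t C) = x"
      using t unfolding f_def by (simp add: m_assoc)
    show "\<forall>p\<in>carrier (G Mod N) \<times> N. f (case p of (C, n) \<Rightarrow> n \<otimes> t C) = p"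
    proof
      fix p assume "p \<in> carrier (G Mod N) \<times> N"
      then obtain x n where p: "p = (N #> x, n)" "x \<in> carrier G" "n \<in> N"
        unfolding carrier_quotient by auto
      have "N #> (n \<otimes> t (N #> x)) = N #> x"
        using p t[OF p(2)] rcos_eq_iff[of "t (N #> x)" "n \<otimes> t (N #> x)"]
        by (simp add: m_assoc)
      then show "f (case p of (C, n) \<Rightarrow> n \<otimes> t C) = p"
        using p t[OF p(2)] unfolding f_def by (simp add: m_assoc)
    qed
    show "f ` carrier G \<subseteq> carrier (G Mod N) \<times> N"
      using f_snd unfolding f_def carrier_quotient by auto
    show "(\<lambda>(C, n). n \<otimes> t C) ` (carrier (G Mod N) \<times> N) \<subseteq> carrier G"
      using t unfolding carrier_quotient by auto
  qed
  have inner: "reindex_matrix (carrier G) f (kronecker (ident_matrix (carrier (G Mod N)))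
      (adj_matrix (cayley_relation (G\<lparr>carrier := N\<rparr>) (conj_class G N g)))) =
      adj_matrix (cayley_relation G (conj_class G N g))" if g: "g \<in> N" for g
  proof (intro ext)
    fix x y
    let ?P = "conj_class G N g"
    have "N #> x = N #> y \<and> (snd (f x), snd (f y)) \<in> cayley_relation (G\<lparr>carrier := N\<rparr>) ?P
        \<longleftrightarrow> (x, y) \<in> cayley_relation G ?P" if x: "x \<in> carrier G" and y: "y \<in> carrier G"
    proof (cases "N #> x = N #> y")
      case True
      let ?t = "t (N #> x)"
      \<comment> \<open>Both points have the same representative, so it cancels.\<close>
      have "y \<otimes> inv ?t \<otimes> inv (x \<otimes> inv ?t) = y \<otimes> inv x"
        using x y t[OF x] by (simp add: m_assoc[symmetric] inv_mult_group) (simp add: m_assoc)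
      moreover have "y \<otimes> inv ?t \<in> N" "x \<otimes> inv ?t \<in> N"
        using f_snd[OF x] f_snd[OF y] True by auto
      ultimately show ?thesis
        using x y True m_inv_consistent[OF subgroup_axioms, of "x \<otimes> inv ?t"]
        unfolding f_def cayley_relation_def by simp
    next
      case False
      then have "y \<otimes> inv x \<notin> N"
        using rcos_eq_iff[OF x y] by auto
      \<comment> \<open>The class of \<open>g \<in> N\<close> stays in \<open>N\<close>, so it
        relates no points of different cosets, and both sides are false.\<close>
      then show ?thesis
        using False conj_class_inside[OF g] unfolding cayley_relation_def by auto
    qed
    then show "reindex_matrix (carrier G) f (kronecker (ident_matrix (carrier (G Mod N)))
        (adj_matrix (cayley_relation (G\<lparr>carrier := N\<rparr>) ?P))) x y =
        adj_matrix (cayley_relation G ?P) x y"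
      unfolding reindex_matrix_def kronecker_def ident_matrix_def adj_matrix_def carrier_quotient
      by (auto simp: f_def cayley_relation_def)
  qed
  \<comment> \<open>The second coordinates of \<open>f\<close> lie in \<open>N\<close>, so the
    all-ones factor contributes 1 and the entry depends on the cosets alone.\<close>
  have outer: "reindex_matrix (carrier G) f (kronecker
      (adj_matrix (cayley_relation (G Mod N) {N #> g})) (ones_matrix N)) =
      adj_matrix (cayley_relation G (N #> g))" if g: "g \<in> carrier G" for g
  proof (intro ext)
    fix x y
    show "reindex_matrix (carrier G) f (kronecker
        (adj_matrix (cayley_relation (G Mod N) {N #> g})) (ones_matrix N)) x y =
        adj_matrix (cayley_relation G (N #> g)) x y"
    proof (cases "x \<in> carrier G \<and> y \<in> carrier G")
      case True
      then show ?thesis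
        using cayley_relation_quotient[OF _ _ g] f_snd
        unfolding reindex_matrix_def kronecker_def ones_matrix_def adj_matrix_def f_def by simp
    next
      case False
      then show ?thesis
        unfolding reindex_matrix_def adj_matrix_def cayley_relation_def by auto
    qed
  qed
  \<comment> \<open>Both families are now indexed by \<open>N\<close> and
    \<open>carrier G - N\<close>, the same split as in \<open>conj_classes_eq\<close>, so they can
    be matched by \<open>inner\<close> and \<open>outer\<close>.\<close>
  have "adj_matrices (wreath_scheme (group_scheme (G\<lparr>carrier := N\<rparr>)) (group_scheme (G Mod N))) =
      (\<lambda>g. kronecker (ident_matrix (carrier (G Mod N)))
        (adj_matrix (cayley_relation (G\<lparr>carrier := N\<rparr>) (conj_class G N g)))) ` N \<union>
      (\<lambda>g. kronecker (adj_matrix (cayley_relation (G Mod N) {N #> g})) (ones_matrix N)) `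
        (carrier G - N)"
    using adj_quotient_nonidentity conj_class_consistent[OF subgroup_axioms]
    by (simp add: wreath_scheme_def group_scheme_def pair_scheme_def conj_classes_def image_image)
  then have "reindex_matrix (carrier G) f ` adj_matrices
      (wreath_scheme (group_scheme (G\<lparr>carrier := N\<rparr>)) (group_scheme (G Mod N))) =
      adj_matrices (pair_scheme G N)"
    using inner outer
    by (simp add: pair_scheme_def conj_classes_eq image_Un image_image)
  then show ?thesis
    using bij unfolding scheme_iso_def
    by (intro exI[of _ f])
      (simp add: wreath_scheme_def group_scheme_def pair_scheme_def)
qed

end

section \<open>Frobenius groups\<close>

text \<open>Conjugating \<open>g\<close> by distinct elements of \<open>N\<close> gives distinct
  results, so the class has as many elements as the coset. By normality it lies in the coset, and
  finiteness gives equality.\<close>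

lemma (in group) frobenius_conj_class:
  assumes "finite (carrier G)" "frobenius_kernel N G" "g \<in> carrier G" "g \<notin> N"
  shows "conj_class G N g = N #> g"
proof -
  interpret normal N G
    using assms(2) unfolding frobenius_kernel_def by simp
  have "inj_on (\<lambda>h. inv h \<otimes> g \<otimes> h) N"
  proof (rule inj_onI)
    fix h k assume hk: "h \<in> N" "k \<in> N" and eq: "inv h \<otimes> g \<otimes> h = inv k \<otimes> g \<otimes> k"
    have G: "h \<in> carrier G" "k \<in> carrier G"
      using hk by auto
    \<comment> \<open>Equal conjugates make \<open>h \<otimes> inv k\<close> commute with
      \<open>g\<close>. As \<open>g \<notin> N\<close>, the Frobenius condition leaves only the
      identity for this element of \<open>N\<close>.\<close>
    have "g \<otimes> (h \<otimes> inv k) = h \<otimes> (inv h \<otimes> g \<otimes> h) \<otimes> inv k"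
      using G assms(3) by (simp add: m_assoc[symmetric])
    also have "\<dots> = (h \<otimes> inv k) \<otimes> g"
      unfolding eq using G assms(3) by (simp add: m_assoc)
    finally have "g \<in> centralizer G (h \<otimes> inv k)"
      using assms(3) unfolding centralizer_def by simp
    then have "h \<otimes> inv k = \<one>"
      using assms(2,4) hk unfolding frobenius_kernel_def by blast
    then show "h = k"
      using G by (metis inv_equality inv_inv inv_closed)
  qed
  then have "card (conj_class G N g) = card N"
    unfolding conj_class_def by (metis card_image Setcompr_eq_image)
  also have "\<dots> = card (N #> g)"
    using assms(3) by (intro card_rcosets_equal rcosetsI subset) auto
  finally have card: "card (conj_class G N g) = card (N #> g)" .
  have "conj_class G N g \<subseteq> N #> g"
  proof
    fix x assume "x \<in> conj_class G N g"
    then obtain h where h: "h \<in> N" "x = inv h \<otimes> g \<otimes> h"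
      unfolding conj_class_def by auto
    have "x \<otimes> inv g = inv h \<otimes> (g \<otimes> h \<otimes> inv g)"
      using h assms(3) by (simp add: m_assoc)
    also have "\<dots> \<in> N"
      using h assms(3) inv_op_closed2 by simp
    finally show "x \<in> N #> g"
      using h assms(3) by (intro rcos_module_rev[OF is_group]) auto
  qed
  moreover have "finite (N #> g)"
    using assms(1,3) r_coset_subset_G[OF subset] finite_subset by blast
  ultimately show ?thesis
    using card by (intro card_subset_eq)
qed

text \<open>For a fixed \<open>g\<close> outside \<open>N\<close>, the element
  \<open>n \<otimes> g\<close> of the coset is an \<open>N\<close>-conjugate of \<open>g\<close>,
  which exhibits \<open>n\<close> as the commutator of \<open>inv h\<close> and \<open>g\<close> for
  some \<open>h \<in> N\<close>.\<close>

lemma (in group) frobenius_kernel_subset_derived: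
  assumes "finite (carrier G)" "frobenius_kernel N G"
  shows "N \<subseteq> derived G (carrier G)"
proof
  interpret normal N G
    using assms(2) unfolding frobenius_kernel_def by simp
  fix n assume n: "n \<in> N"
  obtain g where g: "g \<in> carrier G" "g \<notin> N"
    using assms(2) subset unfolding frobenius_kernel_def by auto
  have "n \<otimes> g \<in> conj_class G N g"
    using frobenius_conj_class[OF assms g] n g subset by (auto intro: rcosI)
  then obtain h where h: "h \<in> N" "n \<otimes> g = inv h \<otimes> g \<otimes> h"
    unfolding conj_class_def by auto
  have "n = n \<otimes> g \<otimes> inv g"
    using n g by (simp add: m_assoc)
  \<comment> \<open>The double inverse brings the product into the commutator form of
    \<open>derived_set\<close>.\<close>
  also have "\<dots> = inv h \<otimes> g \<otimes> inv (inv h) \<otimes> inv g"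
    unfolding h(2) using h(1) by simp
  also have "\<dots> \<in> derived_set G (carrier G)"
    using h(1) g inv_closed[of h] mem_carrier[of h] by blast
  finally show "n \<in> derived G (carrier G)"
    unfolding derived_def by (rule generate.incl)
qed

text \<open>Since \<open>H <#> K\<close> is the whole group, every coset has a representative in
  \<open>K\<close>, and products of cosets inherit commutativity from these representatives.\<close>

lemma (in normal) quotient_comm_of_complement:
  assumes "group_complement K H G" "comm_group (G\<lparr>carrier := K\<rparr>)"
  shows "comm_group (G Mod H)"
proof (rule group.group_comm_groupI[OF factorgroup_is_group])
  have K: "subgroup K G" "H <#> K = carrier G"
    using assms(1) unfolding group_complement_def by auto
  have rep: "\<exists>k\<in>K. X = H #> k" if X: "X \<in> carrier (G Mod H)" for X
  proof -
    obtain g where g: "g \<in> carrier G" "X = H #> g"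
      using X by (auto simp: FactGroup_def RCOSETS_def)
    obtain h k where hk: "h \<in> H" "k \<in> K" "g = h \<otimes> k"
      using g(1) K(2) unfolding set_mult_def by blast
    have "k \<in> carrier G"
      using hk K(1) by (auto dest: subgroup.mem_carrier)
    moreover have "g \<in> H #> k"
      using hk calculation subset by (auto intro: rcosI)
    ultimately have "X = H #> k"
      using g(2) repr_independence subgroup_axioms by metis
    then show ?thesis using hk by auto
  qed
  fix X Y assume "X \<in> carrier (G Mod H)" "Y \<in> carrier (G Mod H)"
  then obtain k l where kl: "k \<in> K" "l \<in> K" "X = H #> k" "Y = H #> l"
    using rep by metis
  moreover have "k \<in> carrier G" "l \<in> carrier G"
    using kl K(1) by (auto dest: subgroup.mem_carrier)
  moreover have "k \<otimes> l = l \<otimes> k"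
    using comm_monoid.m_comm[OF comm_group.axioms(1)[OF assms(2)], of k l] kl by simp
  ultimately show "X \<otimes>\<^bsub>G Mod H\<^esub> Y = Y \<otimes>\<^bsub>G Mod H\<^esub> X"
    by (simp add: rcos_sum)
qed

theorem corollary4p5:
  fixes G :: "('a, 'm) monoid_scheme" and N K :: "'a set"
  assumes "group G" and "finite (carrier G)"
    and "frobenius_kernel N G"
    and "group_complement K N G"
    and "comm_group (G\<lparr>carrier := K\<rparr>)"
  shows "derived G (carrier G) = N \<and>
         strong_gelfand_pair G (derived G (carrier G)) \<and>
         scheme_iso (pair_scheme G (derived G (carrier G)))
           (wreath_scheme (group_scheme (G\<lparr>carrier := derived G (carrier G)\<rparr>))
                          (group_scheme (G Mod derived G (carrier G))))"
proof -
  interpret group G by fact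
  interpret normal N G
    using assms(3) unfolding frobenius_kernel_def by simp
  have comm: "comm_group (G Mod N)"
    by (rule quotient_comm_of_complement[OF assms(4,5)])
  interpret coset_class_pair N G
    using comm frobenius_conj_class[OF assms(2,3)] normal_axioms
    by (intro coset_class_pair.intro coset_class_pair_axioms.intro)
  \<comment> \<open>One inclusion writes elements of \<open>N\<close> as commutators; the other
    holds because the derived subgroup lies in every normal subgroup with abelian quotient.\<close>
  have "derived G (carrier G) = N"
    using frobenius_kernel_subset_derived[OF assms(2,3)]
      derived_minimal[OF normal_axioms comm] by auto
  moreover have "strong_gelfand_pair G N"
    using schur_ring_comm[OF assms(2)] assms(1,2) subgroup_axioms
    unfolding strong_gelfand_pair_def by blast
  ultimately show ?thesis
    using pair_scheme_iso_wreath by simp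
qed

end
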